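(* Let $G$ be a mixed interval graph without directed cycles. Then $\chi(G)\le(\lambda(G)+1)\cdot\omega(G)$.
   Context: A mixed interval graph is an interval graph (intersection graph of a finite set of intervals on the real line) in which every adjacent pair is joined either by an undirected edge or by an arc directed arbitrarily. A proper coloring of a mixed graph $G$ is a function $f\colon V(G)\to\mathbb{N}$ such that $f(u)\neq f(v)$ for every edge $\{u,v\}$ and $f(u)<f(v)$ for every arc $(u,v)$; $\chi(G)$ is the minimum number of colors of a proper coloring. $\omega(G)$ is the size of a largest clique in the underlying undirected graph of $G$ (which has an edge for every edge or arc of $G$). A directed path of length $t$ is a sequence of vertices $v_1,\dots,v_{t+1}$ with an arc $(v_i,v_{i+1})$ for each $i\in[t]$, and $\lambda(G)$ is the length of a longest directed path in $G$. *)

theory Defs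
  imports "HOL-Analysis.Analysis"
begin

record 'a mixed_graph =
  verts :: "'a set"
  edges :: "'a set set"
  arcs :: "('a \<times> 'a) set"

text \<open>Finite simple mixed graphs. The last condition makes every adjacent pair joined in exactly
  one way (by an edge or by a single arc); its instance with both ends equal excludes loops.\<close>

definition mixed_graph :: "'a mixed_graph \<Rightarrow> bool" where
  "mixed_graph G \<longleftrightarrow>
     finite (verts G) \<and>
     edges G \<subseteq> {{u, v} | u v. u \<in> verts G \<and> v \<in> verts G \<and> u \<noteq> v} \<and>
     arcs G \<subseteq> verts G \<times> verts G \<and>
     (\<forall>u v. (u, v) \<in> arcs G \<longrightarrow> (v, u) \<notin> arcs G \<and> {u, v} \<notin> edges G)"

definition adjacent :: "'a mixed_graph \<Rightarrow> 'a \<Rightarrow> 'a \<Rightarrow> bool" where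
  "adjacent G u v \<longleftrightarrow> {u, v} \<in> edges G \<or> (u, v) \<in> arcs G \<or> (v, u) \<in> arcs G"

text \<open>Intervals may be open, closed, half-open, degenerate or unbounded.\<close>

definition mixed_interval_graph :: "'a mixed_graph \<Rightarrow> bool" where
  "mixed_interval_graph G \<longleftrightarrow>
     mixed_graph G \<and>
     (\<exists>I :: 'a \<Rightarrow> real set.
        (\<forall>v \<in> verts G. is_interval (I v) \<and> I v \<noteq> {}) \<and>
        (\<forall>u \<in> verts G. \<forall>v \<in> verts G. u \<noteq> v \<longrightarrow>
           (adjacent G u v \<longleftrightarrow> I u \<inter> I v \<noteq> {})))"

definition proper_coloring :: "'a mixed_graph \<Rightarrow> ('a \<Rightarrow> nat) \<Rightarrow> bool" where
  "proper_coloring G f \<longleftrightarrow>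
     (\<forall>u v. {u, v} \<in> edges G \<longrightarrow> f u \<noteq> f v) \<and>
     (\<forall>u v. (u, v) \<in> arcs G \<longrightarrow> f u < f v)"

definition chromatic_number :: "'a mixed_graph \<Rightarrow> nat" where
  "chromatic_number G = (LEAST k. \<exists>f. proper_coloring G f \<and> card (f ` verts G) = k)"

definition clique :: "'a mixed_graph \<Rightarrow> 'a set \<Rightarrow> bool" where
  "clique G C \<longleftrightarrow> C \<subseteq> verts G \<and> pairwise (adjacent G) C"

definition clique_number :: "'a mixed_graph \<Rightarrow> nat" where
  "clique_number G = Max {card C | C. clique G C}"

definition directed_path :: "'a mixed_graph \<Rightarrow> 'a list \<Rightarrow> bool" where
  "directed_path G vs \<longleftrightarrow>
     vs \<noteq> [] \<and> set vs \<subseteq> verts G \<and>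
     (\<forall>i. Suc i < length vs \<longrightarrow> (vs ! i, vs ! Suc i) \<in> arcs G)"

text \<open>Vertices of a directed path may repeat, so the maximum is only meaningful for finite nonempty
  graphs without directed cycles, where repetitions are impossible.\<close>

definition longest_path_length :: "'a mixed_graph \<Rightarrow> nat" where
  "longest_path_length G = Max {t. \<exists>vs. directed_path G vs \<and> length vs = t + 1}"

end

theory Submission
  imports Defs
begin

text \<open>The underlying interval graph has a coloring with \<open>\<omega>\<close> colors (color the intervals greedily by
  left endpoint). Let \<open>l v\<close> be the length of a longest directed path ending in \<open>v\<close>; it increases
  along every arc and is at most \<open>\<lambda>\<close>. If \<open>g\<close> colors the interval graph with colors \<open>0, \<dots>, \<omega> - 1\<close>,
  then \<open>l v * \<omega> + g v\<close> is a proper coloring of the mixed graph.\<close>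

text \<open>Intervals need not have left endpoints; the smallest of finitely many chosen common points
  \<open>q u v\<close> of \<open>I u\<close> with the intervals \<open>I v\<close> meeting it takes the role of the left endpoint of \<open>I u\<close>.\<close>

lemma interval_left_points:
  fixes I :: "'a \<Rightarrow> real set"
  assumes "finite V" and "\<And>v. v \<in> V \<Longrightarrow> is_interval (I v)" and "\<And>v. v \<in> V \<Longrightarrow> I v \<noteq> {}"
  obtains l where "\<And>v. v \<in> V \<Longrightarrow> l v \<in> I v"
    and "\<And>u v. \<lbrakk>u \<in> V; v \<in> V; I u \<inter> I v \<noteq> {}; l u \<le> l v\<rbrakk> \<Longrightarrow> l v \<in> I u"
proof -
  define q where "q u v = (SOME x. x \<in> I u \<inter> I v)" for u v
  have q: "q u v \<in> I u \<inter> I v" if "I u \<inter> I v \<noteq> {}" for u v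
    unfolding q_def using that by (metis some_in_eq)
  \<comment> \<open>The chosen point depends only on the set \<open>I u \<inter> I v\<close>, so one
    and the same point lies in both \<open>Q u\<close> and \<open>Q v\<close>.\<close>
  have q_sym: "q u v = q v u" for u v
    by (simp add: q_def Int_commute)
  define Q where "Q u = q u ` {v \<in> V. I u \<inter> I v \<noteq> {}}" for u
  have fin: "finite (Q u)" for u
    using assms(1) by (simp add: Q_def)
  have in_Q: "q u v \<in> Q u" if "v \<in> V" "I u \<inter> I v \<noteq> {}" for u v
    using that by (auto simp: Q_def)
  have Min_in_I: "Min (Q v) \<in> I v" if "v \<in> V" for v
  proof -
    have "Q v \<noteq> {}" using in_Q[of v v] that assms(3) by auto
    then have "Min (Q v) \<in> Q v" using fin by simp
    then obtain u where "I v \<inter> I u \<noteq> {}" "Min (Q v) = q v u"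
      unfolding Q_def by (elim imageE CollectE conjE)
    then show ?thesis using q[of v u] by simp
  qed
  show thesis
  proof
    show "Min (Q v) \<in> I v" if "v \<in> V" for v
      using Min_in_I that .
    fix u v assume uv: "u \<in> V" "v \<in> V" "I u \<inter> I v \<noteq> {}" "Min (Q u) \<le> Min (Q v)"
    \<comment> \<open>\<open>Min (Q v)\<close> lies between \<open>Min (Q u)\<close> and
      \<open>q u v\<close>; both of these belong to \<open>I u\<close>, so convexity of
      \<open>I u\<close> finishes.\<close>
    have "q u v \<in> Q v"
      using in_Q[of u v] uv by (simp add: q_sym[of u v] Int_commute)
    then have "Min (Q v) \<le> q u v" using fin by simp
    moreover have "q u v \<in> I u" using q uv(3) by blast
    ultimately show "Min (Q v) \<in> I u"
      using assms(2)[OF uv(1)] Min_in_I[OF uv(1)] uv(4) unfolding is_interval_1 by blast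
  qed
qed

text \<open>When intervals are colored in order of their left points, all earlier intervals meeting
  \<open>I x\<close> contain \<open>l x\<close>. Together with \<open>x\<close> they form a clique,
  so at most \<open>k - 1\<close> colors are blocked for \<open>x\<close>.\<close>

lemma interval_graph_coloring:
  fixes I :: "'a \<Rightarrow> real set"
  assumes "finite V" and "\<And>v. v \<in> V \<Longrightarrow> is_interval (I v)" and "\<And>v. v \<in> V \<Longrightarrow> I v \<noteq> {}"
    and clique_le: "\<And>C. \<lbrakk>C \<subseteq> V; pairwise (\<lambda>u v. I u \<inter> I v \<noteq> {}) C\<rbrakk> \<Longrightarrow> card C \<le> k"
  obtains g where "g ` V \<subseteq> {..<k}" and "pairwise (\<lambda>u v. I u \<inter> I v \<noteq> {} \<longrightarrow> g u \<noteq> g v) V"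
proof -
  obtain l where l_in: "\<And>v. v \<in> V \<Longrightarrow> l v \<in> I v"
    and l_left: "\<And>u v. \<lbrakk>u \<in> V; v \<in> V; I u \<inter> I v \<noteq> {}; l u \<le> l v\<rbrakk> \<Longrightarrow> l v \<in> I u"
    using interval_left_points[of V I] assms(1-3) by blast
  have "\<exists>g. g ` W \<subseteq> {..<k} \<and> pairwise (\<lambda>u v. I u \<inter> I v \<noteq> {} \<longrightarrow> g u \<noteq> g v) W"
    if "finite W" "W \<subseteq> V" for W
    using that
  proof (induction W rule: finite_ranking_induct[where f = l])
    case empty
    then show ?case by simp
  next
    case (insert x S)
    show ?case
    \<comment> \<open>The induction rule gives that \<open>l x\<close> is at least every value of
      \<open>l\<close> on \<open>S\<close>, but not that \<open>x\<close> is new.\<close>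
    proof (cases "x \<in> S")
      case True
      then show ?thesis using insert by (simp add: insert_absorb)
    next
      case False
      from insert obtain g where g: "g ` S \<subseteq> {..<k}"
        "pairwise (\<lambda>u v. I u \<inter> I v \<noteq> {} \<longrightarrow> g u \<noteq> g v) S" by auto
      define N where "N = {u \<in> S. I u \<inter> I x \<noteq> {}}"
      have finN: "finite N" and xN: "x \<notin> N" and N_sub: "insert x N \<subseteq> V"
        using insert False by (auto simp: N_def)
      \<comment> \<open>The common point \<open>l x\<close> makes the intervals of
        \<open>insert x N\<close> pairwise intersecting.\<close>
      have "l x \<in> I u" if "u \<in> insert x N" for u
        using that insert l_in[of x] l_left[of u x] by (auto simp: N_def)
      then have "card (insert x N) \<le> k"
        by (intro clique_le N_sub) (auto simp: pairwise_def)
      then have "card (g ` N) < k"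
        using finN xN card_image_le[of N g] by simp
      then have "\<not> {..<k} \<subseteq> g ` N"
        using finN card_mono[of "g ` N" "{..<k}"] by auto
      then obtain c where c: "c < k" "c \<notin> g ` N" by auto
      have "(g(x := c)) ` insert x S \<subseteq> {..<k}"
        using c g(1) by auto
      moreover have "pairwise (\<lambda>u v. I u \<inter> I v \<noteq> {} \<longrightarrow> (g(x := c)) u \<noteq> (g(x := c)) v) (insert x S)"
        using g(2) c(2) False by (auto simp: pairwise_insert pairwise_def N_def)
      ultimately show ?thesis by blast
    qed
  qed
  from this[of V] show thesis using that assms(1) by auto
qed

text \<open>A repeated vertex would be reachable from itself along the arcs between its two
  occurrences, which is a directed cycle.\<close>

lemma directed_path_distinct:
  assumes "directed_path G vs" and "acyclic (arcs G)"
  shows "distinct vs"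
proof -
  have reach: "(vs ! i, vs ! j) \<in> (arcs G)\<^sup>+" if "i < j" "j < length vs" for i j
    using that
  proof (induction j)
    case (Suc j)
    then have "(vs ! j, vs ! Suc j) \<in> arcs G"
      using assms(1) by (simp add: directed_path_def)
    then show ?case
      using Suc by (cases "i = j") (auto intro: trancl_into_trancl)
  qed simp
  have "vs ! i \<noteq> vs ! j" if "i < j" "j < length vs" for i j
    using reach[OF that] assms(2) by (auto simp: acyclic_def)
  then show ?thesis
    unfolding distinct_conv_nth by (metis linorder_neqE_nat)
qed

lemma directed_path_snoc:
  assumes "directed_path G vs" and "(last vs, v) \<in> arcs G" and "v \<in> verts G"
  shows "directed_path G (vs @ [v])"
  unfolding directed_path_def
proof (intro conjI allI impI)
  fix i assume "Suc i < length (vs @ [v])"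
  then consider "Suc i < length vs" | "Suc i = length vs" by fastforce
  then show "((vs @ [v]) ! i, (vs @ [v]) ! Suc i) \<in> arcs G"
  proof cases
    case 1
    then show ?thesis using assms(1) by (simp add: directed_path_def nth_append)
  next
    case 2
    then have "vs ! i = last vs"
      using assms(1) by (metis diff_Suc_1 directed_path_def last_conv_nth)
    then show ?thesis using 2 assms(2) by (simp add: nth_append)
  qed
qed (use assms in \<open>auto simp: directed_path_def\<close>)

text \<open>Finiteness ensures that the \<open>Max\<close> in \<open>longest_path_length\<close> is
  a true maximum.\<close>

lemma finite_directed_paths:
  assumes "finite (verts G)" and "acyclic (arcs G)"
  shows "finite {vs. directed_path G vs}"
proof (rule finite_subset)
  show "{vs. directed_path G vs} \<subseteq> {vs. set vs \<subseteq> verts G \<and> distinct vs}"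
    using directed_path_distinct[OF _ assms(2)] by (auto simp: directed_path_def)
qed (rule finite_subset_distinct[OF assms(1)])

lemma longest_path_layering:
  assumes "mixed_graph G" and "acyclic (arcs G)"
  obtains l where "\<And>v. v \<in> verts G \<Longrightarrow> l v \<le> longest_path_length G"
    and "\<And>u v. (u, v) \<in> arcs G \<Longrightarrow> l u < l v"
proof -
  have arcs_sub: "arcs G \<subseteq> verts G \<times> verts G" and fin_verts: "finite (verts G)"
    using assms(1) by (auto simp: mixed_graph_def)
  define T where "T = {t. \<exists>vs. directed_path G vs \<and> length vs = t + 1}"
  define Tv where "Tv v = {t. \<exists>vs. directed_path G vs \<and> last vs = v \<and> length vs = t + 1}" for v
  have "T \<subseteq> (\<lambda>vs. length vs - 1) ` {vs. directed_path G vs}"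
    by (force simp: T_def)
  then have fin_T: "finite T"
    using finite_directed_paths[OF fin_verts assms(2)] finite_surj by blast
  have Tv_sub: "Tv v \<subseteq> T" for v by (auto simp: T_def Tv_def)
  then have fin_Tv: "finite (Tv v)" for v using fin_T finite_subset by blast
  \<comment> \<open>The one-vertex path keeps \<open>Tv v\<close> nonempty, so that its
    \<open>Max\<close> is attained by some path ending in \<open>v\<close>.\<close>
  have "0 \<in> Tv v" if "v \<in> verts G" for v
    using that by (auto simp: Tv_def directed_path_def intro!: exI[of _ "[v]"])
  then have Max_in: "Max (Tv v) \<in> Tv v" if "v \<in> verts G" for v
    using that fin_Tv by (metis Max_in empty_iff)
  show thesis
  proof
    show "Max (Tv v) \<le> longest_path_length G" if "v \<in> verts G" for v
      unfolding longest_path_length_def T_def[symmetric]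
      using Max_in[OF that] Tv_sub fin_T by (intro Max_ge) auto
    fix u v assume uv: "(u, v) \<in> arcs G"
    then have "u \<in> verts G" "v \<in> verts G" using arcs_sub by auto
    from Max_in[OF this(1)] obtain vs
      where vs: "directed_path G vs" "last vs = u" "length vs = Max (Tv u) + 1"
      by (auto simp: Tv_def)
    \<comment> \<open>Extending a longest path into \<open>u\<close> by the arc to \<open>v\<close>
      makes the layer strictly increase.\<close>
    have "directed_path G (vs @ [v])"
      using directed_path_snoc vs uv \<open>v \<in> verts G\<close> by metis
    then have "Suc (Max (Tv u)) \<in> Tv v"
      using vs(3) by (auto simp: Tv_def intro!: exI[of _ "vs @ [v]"])
    then show "Max (Tv u) < Max (Tv v)"
      using fin_Tv by (simp add: Suc_le_eq[symmetric])
  qed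
qed

lemma clique_card_le_clique_number:
  assumes "finite (verts G)" and "clique G C"
  shows "card C \<le> clique_number G"
proof -
  have "{card C | C. clique G C} \<subseteq> card ` Pow (verts G)"
    by (auto simp: clique_def)
  then have "finite {card C | C. clique G C}"
    using assms(1) finite_surj by blast
  then show ?thesis
    unfolding clique_number_def using assms(2) by (intro Max_ge) auto
qed

lemma chromatic_number_le:
  assumes "proper_coloring G f" and "f ` verts G \<subseteq> {..<n}"
  shows "chromatic_number G \<le> n"
proof -
  have "chromatic_number G \<le> card (f ` verts G)"
    unfolding chromatic_number_def by (rule Least_le) (use assms(1) in blast)
  also have "\<dots> \<le> n"
    using card_mono[OF _ assms(2)] by simp
  finally show ?thesis .
qed

theorem theorem7:
  fixes G :: "'a mixed_graph"
  assumes "mixed_interval_graph G"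
    and "acyclic (arcs G)"
  shows "chromatic_number G \<le> (longest_path_length G + 1) * clique_number G"
proof -
  let ?w = "clique_number G"
  have mg: "mixed_graph G" using assms(1) by (simp add: mixed_interval_graph_def)
  from assms(1) obtain I :: "'a \<Rightarrow> real set"
    where I_all: "\<forall>v\<in>verts G. is_interval (I v) \<and> I v \<noteq> {}"
      and adj_all: "\<forall>u\<in>verts G. \<forall>v\<in>verts G. u \<noteq> v \<longrightarrow> (adjacent G u v \<longleftrightarrow> I u \<inter> I v \<noteq> {})"
    unfolding mixed_interval_graph_def by (elim conjE exE)
  have I: "is_interval (I v)" "I v \<noteq> {}" if "v \<in> verts G" for v
    using I_all that by auto
  have adj: "adjacent G u v \<longleftrightarrow> I u \<inter> I v \<noteq> {}" if "u \<in> verts G" "v \<in> verts G" "u \<noteq> v" for u v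
    using adj_all that by simp
  have fin: "finite (verts G)" and arcs_sub: "arcs G \<subseteq> verts G \<times> verts G"
    and edges_sub: "edges G \<subseteq> {{u, v} | u v. u \<in> verts G \<and> v \<in> verts G \<and> u \<noteq> v}"
    using mg by (auto simp: mixed_graph_def)
  \<comment> \<open>Adjacency agrees with intersection only for distinct vertices, and
    \<open>pairwise\<close> asks about no others.\<close>
  have clique_le: "card C \<le> ?w" if "C \<subseteq> verts G" "pairwise (\<lambda>u v. I u \<inter> I v \<noteq> {}) C" for C
  proof (rule clique_card_le_clique_number[OF fin])
    show "clique G C"
      using that adj unfolding clique_def pairwise_def by blast
  qed
  obtain g where g_lt: "g ` verts G \<subseteq> {..<?w}"
    and g: "pairwise (\<lambda>u v. I u \<inter> I v \<noteq> {} \<longrightarrow> g u \<noteq> g v) (verts G)"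
    by (rule interval_graph_coloring[OF fin I clique_le])
  obtain l where l_le: "\<And>v. v \<in> verts G \<Longrightarrow> l v \<le> longest_path_length G"
    and l_less: "\<And>u v. (u, v) \<in> arcs G \<Longrightarrow> l u < l v"
    using longest_path_layering[OF mg assms(2)] by blast
  define f where "f v = l v * ?w + g v" for v
  \<comment> \<open>As \<open>g v < ?w\<close>, the residue of \<open>f v\<close> recovers
    \<open>g v\<close>; hence the ends of an edge get different colors whatever their layers
    are.\<close>
  have f_mod: "f v mod ?w = g v" if "v \<in> verts G" for v
    using g_lt that by (auto simp: f_def)
  \<comment> \<open>Layer \<open>l v\<close> owns the block of \<open>?w\<close> colors starting at
    \<open>l v * ?w\<close>. This is used twice: with \<open>n\<close> the layer of an arc's head,
    and with \<open>n = longest_path_length G + 1\<close> for the total number of colors.\<close>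
  have f_less: "f v < n * ?w" if "v \<in> verts G" "l v < n" for v n
  proof -
    have "f v < Suc (l v) * ?w" using g_lt that(1) by (auto simp: f_def)
    also have "\<dots> \<le> n * ?w" using that(2) by (intro mult_le_mono1) simp
    finally show ?thesis .
  qed
  have "proper_coloring G f"
    unfolding proper_coloring_def
  proof (intro conjI allI impI)
    fix u v assume uv: "{u, v} \<in> edges G"
    then have V: "u \<in> verts G" "v \<in> verts G" "u \<noteq> v"
      using edges_sub by (auto simp: doubleton_eq_iff)
    moreover have "adjacent G u v" using uv by (simp add: adjacent_def)
    ultimately have "g u \<noteq> g v" using g adj by (auto simp: pairwise_def)
    then show "f u \<noteq> f v" using f_mod V by metis
  next
    fix u v assume uv: "(u, v) \<in> arcs G"
    then have "f u < l v * ?w" using arcs_sub l_less by (intro f_less) auto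
    then show "f u < f v" by (simp add: f_def)
  qed
  moreover have "f ` verts G \<subseteq> {..<(longest_path_length G + 1) * ?w}"
    using l_le by (intro image_subsetI lessThan_iff[THEN iffD2] f_less) (auto simp: less_Suc_eq_le)
  ultimately show ?thesis by (rule chromatic_number_le)
qed

end
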